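(* $\mathrm{TPTL}[F]\not\subseteq\mathrm{MTL}[U,S]$ over strictly monotonic timed words, and hence also over weakly monotonic timed words: there is a TPTL$[F]$ formula $\phi$ such that no MTL$[U,S]$ formula $\psi$ is satisfied (at position 1) by exactly the same strictly monotonic timed words as $\phi$.
   Context: Fix a finite alphabet $\Sigma$. A (weakly monotonic) timed word is $\rho=(\sigma_1,\tau_1)\cdots(\sigma_n,\tau_n)$, $n\ge1$, $\sigma_i\in\Sigma$, $\tau_i\in\mathbb{R}_{\ge0}$, $\tau_1=0$, $\tau_i\le\tau_{i+1}$; strictly monotonic if $\tau_i<\tau_{i+1}$. An interval is a convex subset of $\mathbb{R}_{\ge0}$ with endpoints non-negative integers or $\infty$. MTL$[U,S]$: $\phi::=a\mid\phi\wedge\phi\mid\neg\phi\mid\phi U_I\phi\mid\phi S_I\phi$ ($a\in\Sigma$, $I$ any interval), with $\rho,i\models a$ iff $\sigma_i=a$, $\rho,i\models\phi_1U_I\phi_2$ iff $\exists j>i$: $\rho,j\models\phi_2$, $\tau_j-\tau_i\in I$, $\forall i<k<j$: $\rho,k\models\phi_1$; $\rho,i\models\phi_1S_I\phi_2$ iff $\exists j<i$: $\rho,j\models\phi_2$, $\tau_i-\tau_j\in I$, $\forall j<k<i$: $\rho,k\models\phi_1$. TPTL$[F]$: fix a finite set $\mathcal{X}$ of freeze variables; valuations $\nu:\mathcal{X}\to\mathbb{R}_{\ge0}$, $\nu_0\equiv0$; guards $g::=g\wedge g\mid x-T\approx c$ with $\approx\in\{<,\le,>,\ge,=\}$, $c\in\mathbb{Z}$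 (so $T-x\approx c$ is also expressible), $\nu,t\models x-T\approx c$ iff $\nu(x)-t\approx c$; formulas $\phi::=a\mid g\mid F\phi\mid x.\phi\mid\phi\vee\phi\mid\neg\phi$, with $\rho,i,\nu\models g$ iff $\nu,\tau_i\models g$, $\rho,i,\nu\models F\phi$ iff $\exists j>i$: $\rho,j,\nu\models\phi$, $\rho,i,\nu\models x.\phi$ iff $\rho,i,\nu[x\mapsto\tau_i]\models\phi$. A TPTL formula holds of $\rho$ if $\rho,1,\nu_0\models\phi$; an MTL formula if $\rho,1\models\psi$. *)

theory Defs
  imports Complex_Main
begin

text \<open>
  Positions are list indices, so position \<open>i\<close> of the usual 1-based numbering is index \<open>i - 1\<close>.
\<close>

type_synonym 'a tword = "('a \<times> real) list"

definition letter :: "'a tword \<Rightarrow> nat \<Rightarrow> 'a" where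
  "letter \<rho> i = fst (\<rho> ! i)"

definition time :: "'a tword \<Rightarrow> nat \<Rightarrow> real" where
  "time \<rho> i = snd (\<rho> ! i)"

definition timed_word :: "'a tword \<Rightarrow> bool" where
  "timed_word \<rho> \<longleftrightarrow> \<rho> \<noteq> [] \<and> (\<forall>i < length \<rho>. time \<rho> i \<ge> 0) \<and> time \<rho> 0 = 0 \<and>
     (\<forall>i. Suc i < length \<rho> \<longrightarrow> time \<rho> i \<le> time \<rho> (Suc i))"

definition strict_timed_word :: "'a tword \<Rightarrow> bool" where
  "strict_timed_word \<rho> \<longleftrightarrow> timed_word \<rho> \<and>
     (\<forall>i. Suc i < length \<rho> \<longrightarrow> time \<rho> i < time \<rho> (Suc i))"

typedef nat_interval =
  "{I :: real set. \<exists>a b :: nat.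
      I = {real a..real b} \<or> I = {real a..<real b} \<or>
      I = {real a<..real b} \<or> I = {real a<..<real b} \<or>
      I = {real a..} \<or> I = {real a<..}}"
  by blast

datatype 'a mtl =
    MLetter 'a
  | MAnd "'a mtl" "'a mtl"
  | MNot "'a mtl"
  | MUntil "'a mtl" nat_interval "'a mtl"
  | MSince "'a mtl" nat_interval "'a mtl"

primrec mtl_sat :: "'a tword \<Rightarrow> nat \<Rightarrow> 'a mtl \<Rightarrow> bool" where
  "mtl_sat \<rho> i (MLetter a) \<longleftrightarrow> letter \<rho> i = a"
| "mtl_sat \<rho> i (MAnd \<phi> \<psi>) \<longleftrightarrow> mtl_sat \<rho> i \<phi> \<and> mtl_sat \<rho> i \<psi>"
| "mtl_sat \<rho> i (MNot \<phi>) \<longleftrightarrow> \<not> mtl_sat \<rho> i \<phi>"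
| "mtl_sat \<rho> i (MUntil \<phi> I \<psi>) \<longleftrightarrow>
     (\<exists>j. i < j \<and> j < length \<rho> \<and> mtl_sat \<rho> j \<psi> \<and> time \<rho> j - time \<rho> i \<in> Rep_nat_interval I \<and>
       (\<forall>k. i < k \<and> k < j \<longrightarrow> mtl_sat \<rho> k \<phi>))"
| "mtl_sat \<rho> i (MSince \<phi> I \<psi>) \<longleftrightarrow>
     (\<exists>j. j < i \<and> mtl_sat \<rho> j \<psi> \<and> time \<rho> i - time \<rho> j \<in> Rep_nat_interval I \<and>
       (\<forall>k. j < k \<and> k < i \<longrightarrow> mtl_sat \<rho> k \<phi>))"

definition mtl_holds :: "'a tword \<Rightarrow> 'a mtl \<Rightarrow> bool" where
  "mtl_holds \<rho> \<psi> \<longleftrightarrow> mtl_sat \<rho> 0 \<psi>"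

datatype cmp = Lt | Le | Gt | Ge | Eq

primrec cmp_rel :: "cmp \<Rightarrow> real \<Rightarrow> real \<Rightarrow> bool" where
  "cmp_rel Lt u v \<longleftrightarrow> u < v"
| "cmp_rel Le u v \<longleftrightarrow> u \<le> v"
| "cmp_rel Gt u v \<longleftrightarrow> u > v"
| "cmp_rel Ge u v \<longleftrightarrow> u \<ge> v"
| "cmp_rel Eq u v \<longleftrightarrow> u = v"

text \<open>\<open>GCmp x r c\<close> is the guard \<open>x - T r c\<close>, where \<open>T\<close> denotes the current time.\<close>

datatype 'x guard =
    GAnd "'x guard" "'x guard"
  | GCmp 'x cmp int

primrec guard_sat :: "('x \<Rightarrow> real) \<Rightarrow> real \<Rightarrow> 'x guard \<Rightarrow> bool" where
  "guard_sat \<nu> t (GAnd g h) \<longleftrightarrow> guard_sat \<nu> t g \<and> guard_sat \<nu> t h"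
| "guard_sat \<nu> t (GCmp x r c) \<longleftrightarrow> cmp_rel r (\<nu> x - t) (real_of_int c)"

datatype ('a, 'x) tptl =
    TLetter 'a
  | TGuard "'x guard"
  | TF "('a, 'x) tptl"
  | TFreeze 'x "('a, 'x) tptl"
  | TOr "('a, 'x) tptl" "('a, 'x) tptl"
  | TNot "('a, 'x) tptl"

text \<open>
  Valuations are typed into the reals; those arising from the zero valuation on a timed word
  are automatically non-negative.
\<close>

primrec tptl_sat :: "'a tword \<Rightarrow> nat \<Rightarrow> ('x \<Rightarrow> real) \<Rightarrow> ('a, 'x) tptl \<Rightarrow> bool" where
  "tptl_sat \<rho> i \<nu> (TLetter a) \<longleftrightarrow> letter \<rho> i = a"
| "tptl_sat \<rho> i \<nu> (TGuard g) \<longleftrightarrow> guard_sat \<nu> (time \<rho> i) g"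
| "tptl_sat \<rho> i \<nu> (TF \<phi>) \<longleftrightarrow> (\<exists>j. i < j \<and> j < length \<rho> \<and> tptl_sat \<rho> j \<nu> \<phi>)"
| "tptl_sat \<rho> i \<nu> (TFreeze x \<phi>) \<longleftrightarrow> tptl_sat \<rho> i (\<nu>(x := time \<rho> i)) \<phi>"
| "tptl_sat \<rho> i \<nu> (TOr \<phi> \<psi>) \<longleftrightarrow> tptl_sat \<rho> i \<nu> \<phi> \<or> tptl_sat \<rho> i \<nu> \<psi>"
| "tptl_sat \<rho> i \<nu> (TNot \<phi>) \<longleftrightarrow> \<not> tptl_sat \<rho> i \<nu> \<phi>"

definition tptl_holds :: "'a tword \<Rightarrow> ('a, 'x) tptl \<Rightarrow> bool" where
  "tptl_holds \<rho> \<phi> \<longleftrightarrow> tptl_sat \<rho> 0 (\<lambda>_. 0) \<phi>"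

end

theory Submission
  imports Defs
begin

text \<open>
  A single letter suffices, and the property separating the logics is ``some later event is
  followed by two further events within less than one time unit''. Take a long word whose gaps
  all lie in \<open>[1/4, 1)\<close> and in which no two events are an integer distance apart. Every interval
  that contains a non-integer contains a whole unit interval, and this is hit by some event; so
  an MTL formula cannot tell apart positions that are far from both ends of the word, and the
  notion of ``far'' depends on the formula only. With gaps \<open>1/2 + \<epsilon>\<close> the property fails,
  but shifting one single event in the middle by a little more than \<open>2\<epsilon>\<close> makes it true, while the word stays of the
  above kind.
\<close>

section \<open>Middle positions, generic time sequences and integer intervals\<close>

definition mid :: "nat \<Rightarrow> nat \<Rightarrow> nat \<Rightarrow> bool" where
  "mid n K i \<longleftrightarrow> K \<le> i \<and> i + K < n"

definition alike :: "nat \<Rightarrow> nat \<Rightarrow> nat \<Rightarrow> nat \<Rightarrow> bool" where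
  "alike n K i j \<longleftrightarrow> i < n \<and> j < n \<and> (i = j \<or> mid n K i \<and> mid n K j)"

text \<open>Each condition has its own use: the lower bound 1/4 turns bounds on time into bounds on
  index distance, gaps below 1 cannot jump over an open unit interval, and non-integral distances
  never meet an endpoint of a constraining interval.\<close>

definition generic_times :: "nat \<Rightarrow> (nat \<Rightarrow> real) \<Rightarrow> bool" where
  "generic_times n s \<longleftrightarrow>
     (\<forall>i. Suc i < n \<longrightarrow> 1/4 \<le> s (Suc i) - s i \<and> s (Suc i) - s i < 1) \<and>
     (\<forall>i j. i < j \<and> j < n \<longrightarrow> s j - s i \<notin> \<int>)"

definition agree_outside_mid :: "nat \<Rightarrow> nat \<Rightarrow> (nat \<Rightarrow> real) \<Rightarrow> (nat \<Rightarrow> real) \<Rightarrow> bool" where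
  "agree_outside_mid n K s t \<longleftrightarrow> (\<forall>i < n. \<not> mid n K i \<longrightarrow> s i = t i)"

text \<open>Arbitrary predicates and time sequences replace formulas and words, so that the same
  definition also applies to reversed sequences, whose times may be negative.\<close>

definition until_at ::
  "nat \<Rightarrow> (nat \<Rightarrow> real) \<Rightarrow> real set \<Rightarrow> (nat \<Rightarrow> bool) \<Rightarrow> (nat \<Rightarrow> bool) \<Rightarrow> nat \<Rightarrow> bool" where
  "until_at n s I P Q i \<longleftrightarrow>
     (\<exists>j. i < j \<and> j < n \<and> Q j \<and> s j - s i \<in> I \<and> (\<forall>k. i < k \<and> k < j \<longrightarrow> P k))"

lemma alike_antimono: "alike n K i j \<Longrightarrow> K' \<le> K \<Longrightarrow> alike n K' i j"
  by (auto simp: alike_def mid_def)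

lemma agree_outside_mid_antimono:
  "agree_outside_mid n K s t \<Longrightarrow> K' \<le> K \<Longrightarrow> agree_outside_mid n K' s t"
  by (auto simp: agree_outside_mid_def mid_def)

lemma generic_times_diff_ge:
  assumes "generic_times n s" "i + d < n"
  shows "real d / 4 \<le> s (i + d) - s i"
  using assms(2)
proof (induction d)
  case (Suc d)
  have "1/4 \<le> s (Suc (i + d)) - s (i + d)"
    using assms(1) Suc.prems unfolding generic_times_def by simp
  with Suc show ?case by (simp add: field_simps)
qed simp

lemma generic_times_diff_ge':
  assumes "generic_times n s" "i \<le> j" "j < n"
  shows "real j - real i \<le> 4 * (s j - s i)"
  using generic_times_diff_ge[OF assms(1), of i "j - i"] assms(2,3) by (simp add: of_nat_diff)

text \<open>At the first position with distance above \<open>a\<close>, the predecessor is still at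
  distance at most \<open>a\<close> and the gap is below 1. As gaps are at least 1/4, this position
  comes within 4(a + 1) steps.\<close>

lemma generic_times_hits_unit_interval:
  assumes gen: "generic_times n s" and bound: "i + 4 * (a + 1) < n"
  obtains j where "i < j" "j \<le> i + 4 * (a + 1)" "real a < s j - s i" "s j - s i < real a + 1"
proof -
  define d where "d = (LEAST d. real a < s (i + d) - s i)"
  have ex: "real a < s (i + 4 * (a + 1)) - s i"
    using generic_times_diff_ge[OF gen bound] by simp
  have d: "real a < s (i + d) - s i" "d \<le> 4 * (a + 1)"
    unfolding d_def using LeastI[of "\<lambda>d. real a < s (i + d) - s i", OF ex]
      Least_le[of "\<lambda>d. real a < s (i + d) - s i", OF ex] by auto
  then obtain e where e: "d = Suc e" by (cases d) auto
  have "s (i + e) - s i \<le> real a"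
    using not_less_Least[of e "\<lambda>d. real a < s (i + d) - s i"] e d_def by force
  moreover have "s (Suc (i + e)) - s (i + e) < 1"
    using gen d(2) e bound unfolding generic_times_def by auto
  ultimately show thesis using that[of "i + d"] d e by auto
qed

lemma nat_interval_bound:
  obtains c :: nat
  where "\<And>r. r \<in> Rep_nat_interval I \<Longrightarrow> 0 < r \<Longrightarrow> r \<notin> \<int> \<Longrightarrow>
           \<exists>a\<le>c. real a \<le> r \<and> {real a<..<real a + 1} \<subseteq> Rep_nat_interval I"
    and "(\<forall>r\<in>Rep_nat_interval I. r \<le> real c) \<or> (\<forall>r>real c. r \<in> Rep_nat_interval I)"
proof -
  obtain a b :: nat where ab:
    "Rep_nat_interval I \<in> {{real a..real b}, {real a..<real b}, {real a<..real b},
       {real a<..<real b}} \<or> Rep_nat_interval I \<in> {{real a..}, {real a<..}}"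
    using Rep_nat_interval[of I] by auto
  then show thesis
  proof
    assume I: "Rep_nat_interval I \<in> {{real a..real b}, {real a..<real b}, {real a<..real b},
       {real a<..<real b}}"
    have "\<exists>k\<le>b. real k \<le> r \<and> {real k<..<real k + 1} \<subseteq> Rep_nat_interval I"
      if r: "r \<in> Rep_nat_interval I" "0 < r" "r \<notin> \<int>" for r
    proof -
      define k where "k = nat \<lfloor>r\<rfloor>"
      have k: "real k \<le> r" "r < real k + 1" using r(2) unfolding k_def by linarith+
      \<comment> \<open>This makes r strictly less than b even if the interval is closed, so the
        unit interval above the floor of r ends at b or earlier.\<close>
      have "r \<noteq> real b" using r(3) by auto
      then have "a \<le> r" "r < b" using r(1) I by auto
      then have "real a < real k + 1" "real k < real b" using k by linarith+
      then have "a \<le> k" "k < b" by linarith+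
      then have "real a \<le> real k" "real k + 1 \<le> real b" by linarith+
      then have "{real k<..<real k + 1} \<subseteq> {real a<..<real b}" by auto
      also have "\<dots> \<subseteq> Rep_nat_interval I"
        using I by (elim insertE emptyE) (simp_all add: subset_iff)
      finally have "{real k<..<real k + 1} \<subseteq> Rep_nat_interval I" .
      with \<open>k < b\<close> k(1) show ?thesis by (intro exI[of _ k]) auto
    qed
    moreover have "\<forall>r\<in>Rep_nat_interval I. r \<le> real b" using I by auto
    ultimately show thesis using that by blast
  next
    assume I: "Rep_nat_interval I \<in> {{real a..}, {real a<..}}"
    \<comment> \<open>The floor of r has no bound here. The unit interval at the left endpoint
      serves all r at once, which keeps \<open>c\<close> independent of r.\<close>
    then have "{real a<..<real a + 1} \<subseteq> Rep_nat_interval I"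
      by (elim insertE emptyE) (simp_all add: subset_iff)
    moreover have "real a \<le> r" if "r \<in> Rep_nat_interval I" for r
      using I that by (elim insertE emptyE) simp_all
    moreover have "\<forall>r>real a. r \<in> Rep_nat_interval I"
      using I by (elim insertE emptyE) simp_all
    ultimately show thesis using that by blast
  qed
qed

section \<open>Transfer of until between generic sequences\<close>

text \<open>Any middle position can replace the witness \<open>j\<close>, so only the time
  constraint matters. It holds on a whole unit interval, which some position after \<open>i'\<close>
  hits; the margin 4(c + 1) keeps that position in the middle.\<close>

lemma until_at_transfer_mid:
  assumes gen: "generic_times n s" "generic_times n t"
    and unit: "\<And>r. r \<in> I \<Longrightarrow> 0 < r \<Longrightarrow> r \<notin> \<int> \<Longrightarrow> \<exists>a\<le>c. real a \<le> r \<and> {real a<..<real a + 1} \<subseteq> I"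
    and P: "\<And>k l. alike n K k l \<Longrightarrow> P k \<Longrightarrow> P' l"
    and Q: "\<And>k l. alike n K k l \<Longrightarrow> Q k \<Longrightarrow> Q' l"
    and i: "mid n (K + 4 * (c + 1)) i" and i': "mid n (K + 4 * (c + 1)) i'"
    and j: "i < j" "mid n K j" "Q j" "s j - s i \<in> I" "\<And>k. i < k \<Longrightarrow> k < j \<Longrightarrow> P k"
  shows "until_at n t I P' Q' i'"
proof -
  have jn: "j < n" using j(2) by (auto simp: mid_def)
  have "0 < s j - s i" using generic_times_diff_ge'[OF gen(1), of i j] j(1) jn by auto
  moreover have "s j - s i \<notin> \<int>" using gen(1) j(1) jn by (auto simp: generic_times_def)
  ultimately obtain a where a: "a \<le> c" "real a \<le> s j - s i" "{real a<..<real a + 1} \<subseteq> I" using unit j(4) by blast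
  show ?thesis
  proof (cases "j = Suc i")
    \<comment> \<open>Nothing is known about \<open>P\<close> here, so the new witness must be the
      immediate successor too. A gap below 1 forces \<open>a\<close> = 0, and every gap lies in the
      unit interval at 0.\<close>
    case True
    have lt: "Suc i' < n" using i' by (auto simp: mid_def)
    then have t: "0 < t (Suc i') - t i'" "t (Suc i') - t i' < 1"
      using gen(2) unfolding generic_times_def by force+
    have "s j - s i < 1" using gen(1) jn True unfolding generic_times_def by force
    with a(2) have "a = 0" by linarith
    with t a(3) have "t (Suc i') - t i' \<in> I" by auto
    moreover have "Q' (Suc i')"
      using Q[of j "Suc i'"] j(2,3) jn lt i' by (auto simp: alike_def mid_def)
    ultimately show ?thesis
      unfolding until_at_def using lt by (intro exI[of _ "Suc i'"]) auto
  next
    case False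
    obtain j' where j': "i' < j'" "j' \<le> i' + 4 * (a + 1)" "real a < t j' - t i'" "t j' - t i' < real a + 1"
      using generic_times_hits_unit_interval[OF gen(2), of i' a] i' a(1) by (auto simp: mid_def)
    have mid': "mid n K k" if "i' < k" "k \<le> j'" for k
      using that j'(2) i' a(1) by (auto simp: mid_def)
    \<comment> \<open>\<open>Suc i\<close> lies strictly between \<open>i\<close> and
      \<open>j\<close>, so \<open>P\<close> holds at one middle position, and hence
      \<open>P'\<close> holds at all of them.\<close>
    have "mid n K (Suc i)" using i by (auto simp: mid_def)
    then have "P' k" if "i' < k" "k < j'" for k
      using P[of "Suc i" k] j(5)[of "Suc i"] False j(1) mid'[of k] that
      by (auto simp: alike_def mid_def)
    moreover have "Q' j'"
      using Q[of j j'] j(2,3) mid'[of j'] j'(1) by (auto simp: alike_def mid_def)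
    ultimately show ?thesis
      unfolding until_at_def using j' a(3) mid'[of j'] by (intro exI[of _ j']) (auto simp: mid_def)
  qed
qed

text \<open>Either the old witness can be kept, or it lies in the middle and the previous lemma
  supplies a new one. The margin is twice 4(c + 1): one half covers the distance between
  \<open>i\<close> and a witness within time c, the other the search for the replacement.\<close>

lemma until_at_transfer:
  assumes gen: "generic_times n s" "generic_times n t"
    and unit: "\<And>r. r \<in> I \<Longrightarrow> 0 < r \<Longrightarrow> r \<notin> \<int> \<Longrightarrow>
                 \<exists>a\<le>c. real a \<le> r \<and> {real a<..<real a + 1} \<subseteq> I"
    and bound: "(\<forall>r\<in>I. r \<le> real c) \<or> (\<forall>r>real c. r \<in> I)"
    and agree: "agree_outside_mid n (K + 8 * (c + 1)) s t"
    and P: "\<And>k l. alike n K k l \<Longrightarrow> P k \<Longrightarrow> P' l"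
    and Q: "\<And>k l. alike n K k l \<Longrightarrow> Q k \<Longrightarrow> Q' l"
    and ii': "alike n (K + 8 * (c + 1)) i i'"
    and until: "until_at n s I P Q i"
  shows "until_at n t I P' Q' i'"
proof -
  obtain j where j: "i < j" "j < n" "Q j" "s j - s i \<in> I" "\<And>k. i < k \<Longrightarrow> k < j \<Longrightarrow> P k"
    using until unfolding until_at_def by blast
  note mid_case = until_at_transfer_mid[where P = P and Q = Q, OF gen unit P Q _ _ j(1) _ j(3,4,5)]
  have same: "P k \<Longrightarrow> P' k" "Q k \<Longrightarrow> Q' k" if "k < n" for k
    using P[of k k] Q[of k k] that by (auto simp: alike_def)
  show ?thesis
  proof (cases "mid n (K + 8 * (c + 1)) i \<and> mid n (K + 8 * (c + 1)) i'")
    case mid: True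
    then have mid4: "mid n (K + 4 * (c + 1)) i" "mid n (K + 4 * (c + 1)) i'"
      by (auto simp: mid_def)
    show ?thesis
    proof (cases "mid n K j")
      case True
      with mid4 show ?thesis by (intro mid_case)
    next
      case False
      \<comment> \<open>The witness is near the right end and is kept. Its distance exceeds c from
        both \<open>i\<close> and \<open>i'\<close>, and an interval with one element beyond c
        contains all numbers beyond c.\<close>
      then have far: "n \<le> j + K" using mid j(1) by (auto simp: mid_def)
      have "i + 8 * (c + 1) < j" "i' + 8 * (c + 1) < j" using mid far by (auto simp: mid_def)
      then have "real i + 8 * (real c + 1) < real j" "real i' + 8 * (real c + 1) < real j"
        unfolding of_nat_less_iff[where 'a = real, symmetric] by simp_all
      then have "real c < s j - s i" "real c < t j - t i'"
        using generic_times_diff_ge'[OF gen(1), of i j] generic_times_diff_ge'[OF gen(2), of i' j]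
          j(2) by auto
      with bound j(4) have "t j - t i' \<in> I" by force
      moreover have "P' k" if "i' < k" "k < j" for k
      proof (cases "mid n K k")
        case True
        have "mid n K (Suc i)" "Suc i < j" using mid far by (auto simp: mid_def)
        with True show ?thesis
          using P[of "Suc i" k] j(5)[of "Suc i"] by (auto simp: alike_def mid_def)
      next
        case False
        \<comment> \<open>A position after \<open>i'\<close> outside the middle is near the right
          end, hence also after \<open>i\<close>.\<close>
        then have "i < k" using that mid by (auto simp: mid_def)
        then show ?thesis using same that j(2,5) by auto
      qed
      moreover have "i' < j" using mid far by (auto simp: mid_def)
      ultimately show ?thesis unfolding until_at_def using same j(2,3) by blast
    qed
  next
    case False
    then have eq: "i' = i" using ii' by (auto simp: alike_def)
    show ?thesis
    proof (cases "t j - t i \<in> I")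
      case True
      show ?thesis
        unfolding until_at_def eq using True same j by (intro exI[of _ j]) auto
    next
      case notin: False
      then have "\<not> (s i = t i \<and> s j = t j)" using j(4) by auto
      \<comment> \<open>The witness fails only if the time of \<open>i\<close> or of
        \<open>j\<close> differs, so one of them is deep in the middle. One of the two distances is
        at most c, so the other position is close by.\<close>
      then have mid: "mid n (K + 8 * (c + 1)) i \<or> mid n (K + 8 * (c + 1)) j"
        using agree j(1,2) unfolding agree_outside_mid_def by (meson less_trans)
      have "s j - s i \<le> real c \<or> t j - t i \<le> real c"
        using bound notin j(4) by force
      then have "real j - real i \<le> 4 * real c"
        using generic_times_diff_ge'[OF gen(1), of i j] generic_times_diff_ge'[OF gen(2), of i j]
          j(1,2) by auto
      then have "j \<le> i + 4 * c" by linarith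
      then have "mid n (K + 4 * (c + 1)) i" "mid n K j" using mid j(1) by (auto simp: mid_def)
      then show ?thesis unfolding eq by (intro mid_case)
    qed
  qed
qed

section \<open>Since as until under time reversal\<close>

definition since_at ::
  "(nat \<Rightarrow> real) \<Rightarrow> real set \<Rightarrow> (nat \<Rightarrow> bool) \<Rightarrow> (nat \<Rightarrow> bool) \<Rightarrow> nat \<Rightarrow> bool" where
  "since_at s I P Q i \<longleftrightarrow>
     (\<exists>j. j < i \<and> Q j \<and> s i - s j \<in> I \<and> (\<forall>k. j < k \<and> k < i \<longrightarrow> P k))"

text \<open>Reversing the indices turns past into future; negating the times keeps the sequence
  increasing and preserves distances.\<close>

definition flip_times :: "nat \<Rightarrow> (nat \<Rightarrow> real) \<Rightarrow> nat \<Rightarrow> real" where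
  "flip_times n s i = - s (n - 1 - i)"

lemma since_at_eq_until_at_flip:
  assumes "i < n"
  shows "since_at s I P Q i \<longleftrightarrow>
    until_at n (flip_times n s) I (\<lambda>k. P (n - 1 - k)) (\<lambda>k. Q (n - 1 - k)) (n - 1 - i)"
proof
  assume "since_at s I P Q i"
  then obtain j where j: "j < i" "Q j" "s i - s j \<in> I" "\<And>k. j < k \<Longrightarrow> k < i \<Longrightarrow> P k"
    unfolding since_at_def by blast
  have [simp]: "n - Suc (n - Suc j) = j" "n - Suc (n - Suc i) = i" using j(1) assms by auto
  show "until_at n (flip_times n s) I (\<lambda>k. P (n - 1 - k)) (\<lambda>k. Q (n - 1 - k)) (n - 1 - i)"
    unfolding until_at_def flip_times_def using j assms
    by (intro exI[of _ "n - 1 - j"]) auto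
next
  assume "until_at n (flip_times n s) I (\<lambda>k. P (n - 1 - k)) (\<lambda>k. Q (n - 1 - k)) (n - 1 - i)"
  then obtain j where j: "n - 1 - i < j" "j < n" "Q (n - 1 - j)" "s (n - 1 - (n - 1 - i)) - s (n - 1 - j) \<in> I"
    "\<And>k. n - 1 - i < k \<Longrightarrow> k < j \<Longrightarrow> P (n - 1 - k)"
    unfolding until_at_def flip_times_def by auto
  have ii: "n - 1 - (n - 1 - i) = i" using assms by auto
  have "P k" if k: "n - 1 - j < k" "k < i" for k
  proof -
    have "n - 1 - (n - 1 - k) = k" "n - 1 - i < n - 1 - k" "n - 1 - k < j" using k assms by auto
    then show ?thesis using j(5)[of "n - 1 - k"] by simp
  qed
  moreover have "n - 1 - j < i" using j(1,2) assms by auto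
  ultimately show "since_at s I P Q i" unfolding since_at_def using j(3,4) ii by auto
qed

lemma mid_flip: "i < n \<Longrightarrow> mid n K (n - 1 - i) \<longleftrightarrow> mid n K i"
  by (auto simp: mid_def)

lemma alike_flip: "alike n K i j \<Longrightarrow> alike n K (n - 1 - i) (n - 1 - j)"
  by (auto simp: alike_def mid_def)

lemma agree_outside_mid_flip:
  "agree_outside_mid n K s t \<Longrightarrow> agree_outside_mid n K (flip_times n s) (flip_times n t)"
  unfolding agree_outside_mid_def flip_times_def by (auto simp: mid_flip[simplified])

lemma generic_times_flip:
  assumes "generic_times n s"
  shows "generic_times n (flip_times n s)"
  unfolding generic_times_def
proof (intro conjI allI impI)
  fix i assume "Suc i < n"
  then have "Suc (n - 1 - Suc i) = n - 1 - i" "Suc (n - 1 - Suc i) < n" by auto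
  then show "1/4 \<le> flip_times n s (Suc i) - flip_times n s i"
    and "flip_times n s (Suc i) - flip_times n s i < 1"
    using assms unfolding generic_times_def flip_times_def by (metis minus_diff_minus minus_diff_eq)+
next
  fix i j assume "i < j \<and> j < n"
  then have "n - 1 - j < n - 1 - i" "n - 1 - i < n" by auto
  then show "flip_times n s j - flip_times n s i \<notin> \<int>"
    using assms unfolding generic_times_def flip_times_def by (metis minus_diff_minus minus_diff_eq)
qed

lemma since_at_transfer:
  assumes gen: "generic_times n s" "generic_times n t"
    and unit: "\<And>r. r \<in> I \<Longrightarrow> 0 < r \<Longrightarrow> r \<notin> \<int> \<Longrightarrow>
                 \<exists>a\<le>c. real a \<le> r \<and> {real a<..<real a + 1} \<subseteq> I"
    and bound: "(\<forall>r\<in>I. r \<le> real c) \<or> (\<forall>r>real c. r \<in> I)"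
    and agree: "agree_outside_mid n (K + 8 * (c + 1)) s t"
    and P: "\<And>k l. alike n K k l \<Longrightarrow> P k \<Longrightarrow> P' l"
    and Q: "\<And>k l. alike n K k l \<Longrightarrow> Q k \<Longrightarrow> Q' l"
    and ii': "alike n (K + 8 * (c + 1)) i i'"
    and since: "since_at s I P Q i"
  shows "since_at t I P' Q' i'"
proof -
  have "i < n" "i' < n" using ii' by (auto simp: alike_def)
  note flip = since_at_eq_until_at_flip[OF this(1)] since_at_eq_until_at_flip[OF this(2)]
  show ?thesis
    unfolding flip
    by (rule until_at_transfer[OF generic_times_flip[OF gen(1)] generic_times_flip[OF gen(2)]
          unit bound agree_outside_mid_flip[OF agree] P[OF alike_flip] Q[OF alike_flip]
          alike_flip[OF ii'] since[unfolded flip]])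
qed

section \<open>Invariance of MTL formulas on one-letter words\<close>

definition unary_word :: "'a \<Rightarrow> nat \<Rightarrow> (nat \<Rightarrow> real) \<Rightarrow> 'a tword" where
  "unary_word a n s = map (\<lambda>i. (a, s i)) [0..<n]"

lemma length_unary_word [simp]: "length (unary_word a n s) = n"
  by (simp add: unary_word_def)

lemma letter_unary_word [simp]: "i < n \<Longrightarrow> letter (unary_word a n s) i = a"
  by (simp add: unary_word_def letter_def)

lemma time_unary_word [simp]: "i < n \<Longrightarrow> time (unary_word a n s) i = s i"
  by (simp add: unary_word_def time_def)

lemma mtl_sat_until_unary_word:
  assumes "i < n"
  shows "mtl_sat (unary_word a n s) i (MUntil \<phi> I \<psi>) \<longleftrightarrow>
    until_at n s (Rep_nat_interval I) (\<lambda>k. mtl_sat (unary_word a n s) k \<phi>)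
      (\<lambda>k. mtl_sat (unary_word a n s) k \<psi>) i"
  using assms by (auto simp: until_at_def)

lemma mtl_sat_since_unary_word:
  assumes "i < n"
  shows "mtl_sat (unary_word a n s) i (MSince \<phi> I \<psi>) \<longleftrightarrow>
    since_at s (Rep_nat_interval I) (\<lambda>k. mtl_sat (unary_word a n s) k \<phi>)
      (\<lambda>k. mtl_sat (unary_word a n s) k \<psi>) i"
  using assms by (auto simp: since_at_def)

text \<open>An implication is enough: the hypotheses are symmetric in the two words, so exchanging
  them gives the converse, as negation requires.\<close>

definition mid_invariant :: "'a \<Rightarrow> 'a mtl \<Rightarrow> nat \<Rightarrow> bool" where
  "mid_invariant a \<psi> K \<longleftrightarrow> (\<forall>n s t i j. generic_times n s \<longrightarrow> generic_times n t \<longrightarrow>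
     agree_outside_mid n K s t \<longrightarrow> alike n K i j \<longrightarrow>
     mtl_sat (unary_word a n s) i \<psi> \<longrightarrow> mtl_sat (unary_word a n t) j \<psi>)"

lemma mid_invariantD:
  assumes "mid_invariant a \<psi> K" "generic_times n s" "generic_times n t"
    "agree_outside_mid n K s t" "alike n K i j" "mtl_sat (unary_word a n s) i \<psi>"
  shows "mtl_sat (unary_word a n t) j \<psi>"
  using assms unfolding mid_invariant_def by blast

lemma alike_sym: "alike n K i j \<Longrightarrow> alike n K j i"
  by (auto simp: alike_def)

lemma agree_outside_mid_sym: "agree_outside_mid n K s t \<Longrightarrow> agree_outside_mid n K t s"
  by (auto simp: agree_outside_mid_def)

lemma mid_invariant_mono: "mid_invariant a \<psi> K \<Longrightarrow> K \<le> K' \<Longrightarrow> mid_invariant a \<psi> K'"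
  unfolding mid_invariant_def by (meson alike_antimono agree_outside_mid_antimono)

lemma mid_invariant_both:
  assumes "\<exists>K. mid_invariant a \<phi> K" "\<exists>K. mid_invariant a \<psi> K"
  obtains K where "mid_invariant a \<phi> K" "mid_invariant a \<psi> K"
  using assms mid_invariant_mono by (metis nat_le_linear)

text \<open>Each until or since enlarges the margin by 8(c + 1), with c taken from its interval
  alone. Thus \<open>K\<close> is fixed before the length of the word is chosen.\<close>

lemma ex_mid_invariant: "\<exists>K. mid_invariant a \<psi> K"
proof (induction \<psi>)
  case (MLetter b)
  have "mid_invariant a (MLetter b) 0" by (auto simp: mid_invariant_def alike_def)
  then show ?case ..
next
  case (MAnd \<phi> \<psi>)
  then obtain K where "mid_invariant a \<phi> K" "mid_invariant a \<psi> K" by (rule mid_invariant_both)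
  then have "mid_invariant a (MAnd \<phi> \<psi>) K"
    unfolding mid_invariant_def mtl_sat.simps by blast
  then show ?case ..
next
  case (MNot \<phi>)
  then obtain K where "mid_invariant a \<phi> K" by blast
  then have "mid_invariant a (MNot \<phi>) K"
    unfolding mid_invariant_def mtl_sat.simps by (meson alike_sym agree_outside_mid_sym)
  then show ?case ..
next
  case (MUntil \<phi> I \<psi>)
  then obtain K where K: "mid_invariant a \<phi> K" "mid_invariant a \<psi> K" by (rule mid_invariant_both)
  obtain c where c: "\<And>r. r \<in> Rep_nat_interval I \<Longrightarrow> 0 < r \<Longrightarrow> r \<notin> \<int> \<Longrightarrow>
           \<exists>a\<le>c. real a \<le> r \<and> {real a<..<real a + 1} \<subseteq> Rep_nat_interval I"
    "(\<forall>r\<in>Rep_nat_interval I. r \<le> real c) \<or> (\<forall>r>real c. r \<in> Rep_nat_interval I)"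
    using nat_interval_bound[of I] by metis
  have "mid_invariant a (MUntil \<phi> I \<psi>) (K + 8 * (c + 1))"
    unfolding mid_invariant_def
  proof (intro allI impI)
    fix n s t i j
    assume gen: "generic_times n s" "generic_times n t"
      and agree: "agree_outside_mid n (K + 8 * (c + 1)) s t"
      and ij: "alike n (K + 8 * (c + 1)) i j"
      and sat: "mtl_sat (unary_word a n s) i (MUntil \<phi> I \<psi>)"
    have agreeK: "agree_outside_mid n K s t" using agree by (rule agree_outside_mid_antimono) simp
    have lt: "i < n" "j < n" using ij by (auto simp: alike_def)
    show "mtl_sat (unary_word a n t) j (MUntil \<phi> I \<psi>)"
      unfolding mtl_sat_until_unary_word[OF lt(2)]
      by (rule until_at_transfer[OF gen c agree mid_invariantD[OF K(1) gen agreeK]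
            mid_invariantD[OF K(2) gen agreeK] ij sat[unfolded mtl_sat_until_unary_word[OF lt(1)]]])
  qed
  then show ?case ..
next
  case (MSince \<phi> I \<psi>)
  then obtain K where K: "mid_invariant a \<phi> K" "mid_invariant a \<psi> K" by (rule mid_invariant_both)
  obtain c where c: "\<And>r. r \<in> Rep_nat_interval I \<Longrightarrow> 0 < r \<Longrightarrow> r \<notin> \<int> \<Longrightarrow>
           \<exists>a\<le>c. real a \<le> r \<and> {real a<..<real a + 1} \<subseteq> Rep_nat_interval I"
    "(\<forall>r\<in>Rep_nat_interval I. r \<le> real c) \<or> (\<forall>r>real c. r \<in> Rep_nat_interval I)"
    using nat_interval_bound[of I] by metis
  have "mid_invariant a (MSince \<phi> I \<psi>) (K + 8 * (c + 1))"
    unfolding mid_invariant_def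
  proof (intro allI impI)
    fix n s t i j
    assume gen: "generic_times n s" "generic_times n t"
      and agree: "agree_outside_mid n (K + 8 * (c + 1)) s t"
      and ij: "alike n (K + 8 * (c + 1)) i j"
      and sat: "mtl_sat (unary_word a n s) i (MSince \<phi> I \<psi>)"
    have agreeK: "agree_outside_mid n K s t" using agree by (rule agree_outside_mid_antimono) simp
    have lt: "i < n" "j < n" using ij by (auto simp: alike_def)
    show "mtl_sat (unary_word a n t) j (MSince \<phi> I \<psi>)"
      unfolding mtl_sat_since_unary_word[OF lt(2)]
      by (rule since_at_transfer[OF gen c agree mid_invariantD[OF K(1) gen agreeK]
            mid_invariantD[OF K(2) gen agreeK] ij sat[unfolded mtl_sat_since_unary_word[OF lt(1)]]])
  qed
  then show ?case ..
qed

section \<open>The two words and the separating formula\<close>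

definition perturbed_times :: "nat \<Rightarrow> (nat \<Rightarrow> int) \<Rightarrow> nat \<Rightarrow> real" where
  "perturbed_times n u i = real i / 2 + of_int (u i) / (8 * real n)"

text \<open>A distance is a multiple of 1/2 plus a nonzero error below 1/2 in absolute value, so it
  is never an integer. Between neighbours the error is at most 1/4, so gaps lie between 1/4 and
  3/4.\<close>

lemma generic_times_perturbed:
  assumes small: "\<And>i j. i < n \<Longrightarrow> j < n \<Longrightarrow> \<bar>u j - u i\<bar> < 4 * int n"
    and step: "\<And>i. Suc i < n \<Longrightarrow> \<bar>u (Suc i) - u i\<bar> \<le> 2 * int n"
    and ne: "\<And>i j. i < j \<Longrightarrow> j < n \<Longrightarrow> u i \<noteq> u j"
  shows "generic_times n (perturbed_times n u)"
  unfolding generic_times_def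
proof (intro conjI allI impI)
  have diff: "perturbed_times n u j - perturbed_times n u i
      = (real j - real i) / 2 + of_int (u j - u i) / (8 * real n)" for i j
    unfolding perturbed_times_def by (simp add: diff_divide_distrib)
  {
    fix i assume i: "Suc i < n"
    then have "\<bar>real_of_int (u (Suc i) - u i)\<bar> \<le> 2 * real n" using step[OF i] by linarith
    moreover define e where "e = real_of_int (u (Suc i) - u i) / (8 * real n)"
    ultimately have "\<bar>e\<bar> \<le> 1/4"
      using i by (simp add: abs_divide divide_le_eq)
    then show "1/4 \<le> perturbed_times n u (Suc i) - perturbed_times n u i"
      and "perturbed_times n u (Suc i) - perturbed_times n u i < 1"
      unfolding diff e_def[symmetric] by auto
  }
  {
    fix i j assume ij: "i < j \<and> j < n"
    define e where "e = real_of_int (u j - u i) / (8 * real n)"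
    have "\<bar>real_of_int (u j - u i)\<bar> < 4 * real n" using small[of i j] ij by linarith
    then have e: "\<bar>e\<bar> < 1/2"
      using ij unfolding e_def by (simp add: abs_divide divide_less_eq)
    have e0: "e \<noteq> 0" using ne[of i j] ij unfolding e_def by auto
    show "perturbed_times n u j - perturbed_times n u i \<notin> \<int>"
    proof
      assume "perturbed_times n u j - perturbed_times n u i \<in> \<int>"
      then obtain z where "perturbed_times n u j - perturbed_times n u i = of_int z"
        by (elim Ints_cases)
      \<comment> \<open>An integral distance would make twice the error an integer of absolute value
        below 1, hence 0.\<close>
      then have z: "2 * e = of_int (2 * z - (int j - int i))"
        unfolding diff e_def[symmetric] by (simp add: field_simps)
      have "\<bar>real_of_int (2 * z - (int j - int i))\<bar> < 1" using e unfolding z[symmetric] by linarith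
      then have "2 * z - (int j - int i) = 0" by linarith
      with z e0 show False by simp
    qed
  }
qed

lemma strict_timed_word_unary:
  assumes "generic_times n s" "0 < n" "s 0 = 0"
  shows "strict_timed_word (unary_word a n s)"
proof -
  have "0 \<le> s i" if "i < n" for i
    using generic_times_diff_ge'[OF assms(1), of 0 i] that assms(3) by auto
  moreover have "s i < s (Suc i)" if "Suc i < n" for i
    using assms(1) that unfolding generic_times_def by force
  moreover have "unary_word a n s \<noteq> []" using assms(2) by (simp add: unary_word_def)
  ultimately show ?thesis
    using assms(2,3) unfolding strict_timed_word_def timed_word_def by (auto intro: less_imp_le)
qed

definition two_within_one :: "'x \<Rightarrow> ('a, 'x) tptl" where
  "two_within_one x = TF (TFreeze x (TF (TF (TGuard (GCmp x Gt (-1))))))"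

lemma tptl_holds_two_within_one:
  "tptl_holds (unary_word a n s) (two_within_one x) \<longleftrightarrow>
     (\<exists>i j k. 0 < i \<and> i < j \<and> j < k \<and> k < n \<and> s k - s i < 1)"
proof
  assume "tptl_holds (unary_word a n s) (two_within_one x)"
  then obtain i j k where "0 < i" "i < j" "j < k" "k < n" "- 1 < s i - s k"
    by (auto simp: tptl_holds_def two_within_one_def)
  moreover from this have "s k - s i < 1" by linarith
  ultimately show "\<exists>i j k. 0 < i \<and> i < j \<and> j < k \<and> k < n \<and> s k - s i < 1" by blast
next
  assume "\<exists>i j k. 0 < i \<and> i < j \<and> j < k \<and> k < n \<and> s k - s i < 1"
  then obtain i j k where "0 < i" "i < j" "j < k" "k < n" "s k - s i < 1" by blast
  then have "i < n" "j < n" "- 1 < s i - s k" by auto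
  with \<open>0 < i\<close> \<open>i < j\<close> \<open>j < k\<close> \<open>k < n\<close> show "tptl_holds (unary_word a n s) (two_within_one x)"
    unfolding tptl_holds_def two_within_one_def tptl_sat.simps guard_sat.simps cmp_rel.simps
      length_unary_word
    by (intro exI[of _ i] conjI exI[of _ j] exI[of _ k]) auto
qed

lemma mtl_cannot_express_two_within_one:
  fixes \<psi> :: "'a mtl"
  obtains \<rho> :: "'a tword"
  where "strict_timed_word \<rho>" "mtl_holds \<rho> \<psi> \<noteq> tptl_holds \<rho> (two_within_one x)"
proof -
  define a :: 'a where "a = undefined"
  obtain K where K: "mid_invariant a \<psi> K" using ex_mid_invariant[of a \<psi>] by (elim exE)
  \<comment> \<open>The middle is the block from \<open>K\<close> to \<open>K\<close> + 5, which
    leaves room for \<open>m\<close>, \<open>m + 1\<close> and \<open>m + 2\<close>.\<close>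
  define n where "n = 2 * K + 6"
  define m where "m = Suc K"
  define u where "u i = 2 * int i" for i
  \<comment> \<open>The odd value keeps the offsets distinct and exceeds the offset 2m + 4 of
    position \<open>m + 2\<close> by exactly one unit 1/(8n), which brings the distance just below
    1.\<close>
  define v where "v i = (if i = m then 2 * int m + 5 else 2 * int i)" for i
  define s where "s = perturbed_times n u"
  define t where "t = perturbed_times n v"
  have "0 < n" by (simp add: n_def)
  have gs: "generic_times n s"
    unfolding s_def by (rule generic_times_perturbed) (auto simp: u_def n_def)
  have v_inj: "v i \<noteq> v j" if "i < j" for i j
    using that unfolding v_def by presburger
  have gt: "generic_times n t"
    unfolding t_def
    by (rule generic_times_perturbed)
      (use v_inj in \<open>auto simp: v_def n_def m_def split: if_splits\<close>)
  have agree: "agree_outside_mid n K s t"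
    by (auto simp: agree_outside_mid_def mid_def s_def t_def u_def v_def perturbed_times_def n_def m_def)
  \<comment> \<open>The starting position is alike to itself, so the truth of the formula at the
    start carries over between the two words.\<close>
  have "alike n K 0 0" by (auto simp: alike_def n_def)
  then have "mtl_holds (unary_word a n s) \<psi> \<longleftrightarrow> mtl_holds (unary_word a n t) \<psi>"
    unfolding mtl_holds_def
    using mid_invariantD[OF K gs gt agree] mid_invariantD[OF K gt gs agree_outside_mid_sym[OF agree]]
    by blast
  moreover have "\<not> tptl_holds (unary_word a n s) (two_within_one x)"
  proof -
    have "1 \<le> s k - s i" if "i + 2 \<le> k" for i k
    proof -
      have "real i + 2 \<le> real k" using that by linarith
      moreover from this have "real i / (4 * real n) \<le> real k / (4 * real n)"
        by (intro divide_right_mono) auto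
      ultimately show ?thesis by (simp add: s_def u_def perturbed_times_def)
    qed
    then have "\<not> s k - s i < 1" if "i < j" "j < k" for i j k
      using that by (simp add: not_less)
    then show ?thesis unfolding tptl_holds_two_within_one by blast
  qed
  moreover have "tptl_holds (unary_word a n t) (two_within_one x)"
  proof -
    have "t (m + 2) - t m = 1 - 1 / (8 * real n)"
      using \<open>0 < n\<close> by (simp add: t_def v_def perturbed_times_def field_simps)
    then have "t (m + 2) - t m < 1" by (simp add: n_def)
    moreover have "0 < m" "m < m + 1" "m + 1 < m + 2" "m + 2 < n" by (auto simp: n_def m_def)
    ultimately show ?thesis unfolding tptl_holds_two_within_one by blast
  qed
  moreover have "strict_timed_word (unary_word a n s)" "strict_timed_word (unary_word a n t)"
    by (rule strict_timed_word_unary[OF gs] strict_timed_word_unary[OF gt];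
        simp add: n_def m_def s_def t_def u_def v_def perturbed_times_def)+
  ultimately show thesis using that by blast
qed

theorem theorem5:
  shows "(\<exists>\<phi> :: ('a::finite, 'x::finite) tptl. \<not> (\<exists>\<psi> :: 'a mtl.
            {\<rho>. strict_timed_word \<rho> \<and> mtl_holds \<rho> \<psi>} = {\<rho>. strict_timed_word \<rho> \<and> tptl_holds \<rho> \<phi>}))
       \<and> (\<exists>\<phi> :: ('a, 'x) tptl. \<not> (\<exists>\<psi> :: 'a mtl.
            {\<rho>. timed_word \<rho> \<and> mtl_holds \<rho> \<psi>} = {\<rho>. timed_word \<rho> \<and> tptl_holds \<rho> \<phi>}))"
proof -
  \<comment> \<open>Any freeze variable will do. The separating word is strictly monotonic, hence
    also weakly monotonic, so it settles both conjuncts.\<close>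
  let ?\<phi> = "two_within_one undefined :: ('a, 'x) tptl"
  have "{\<rho>. strict_timed_word \<rho> \<and> mtl_holds \<rho> \<psi>} \<noteq> {\<rho>. strict_timed_word \<rho> \<and> tptl_holds \<rho> ?\<phi>}"
    "{\<rho>. timed_word \<rho> \<and> mtl_holds \<rho> \<psi>} \<noteq> {\<rho>. timed_word \<rho> \<and> tptl_holds \<rho> ?\<phi>}"
    for \<psi> :: "'a mtl"
  proof -
    obtain \<rho> :: "'a tword"
      where "strict_timed_word \<rho>" "mtl_holds \<rho> \<psi> \<noteq> tptl_holds \<rho> ?\<phi>"
      by (rule mtl_cannot_express_two_within_one)
    moreover from this have "timed_word \<rho>" by (simp add: strict_timed_word_def)
    ultimately show "{\<rho>. strict_timed_word \<rho> \<and> mtl_holds \<rho> \<psi>} \<noteq> {\<rho>. strict_timed_word \<rho> \<and> tptl_holds \<rho> ?\<phi>}"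
      "{\<rho>. timed_word \<rho> \<and> mtl_holds \<rho> \<psi>} \<noteq> {\<rho>. timed_word \<rho> \<and> tptl_holds \<rho> ?\<phi>}"
      by blast+
  qed
  then show ?thesis by blast
qed

end
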